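(* Let $\chi_{4,5}$ be the Dirichlet character modulo $5$ with $(\chi_{4,5}(0),\chi_{4,5}(1),\chi_{4,5}(2),\chi_{4,5}(3),\chi_{4,5}(4))=(0,1,-i,i,-1)$. Then, for $|q|<1$, $$\sum_{n=0}^{\infty}\Bigl(\sum_{d\mid5n+4}\chi_{4,5}(d)\Bigr)q^n=\frac{-i\,(q;q)_\infty(q^5;q^5)_\infty}{(q^2;q^5)_\infty^3(q^3;q^5)_\infty^3},$$ $$\sum_{n=0}^{\infty}\Bigl(\sum_{d\mid5n+3}\chi_{4,5}(d)\Bigr)q^n=\frac{(1+i)(q^5;q^5)_\infty^2}{(q^2;q^5)_\infty(q^3;q^5)_\infty},$$ $$\sum_{n=0}^{\infty}\Bigl(\sum_{d\mid5n+2}\chi_{4,5}(d)\Bigr)q^n=\frac{(1-i)(q^5;q^5)_\infty^2}{(q;q^5)_\infty(q^4;q^5)_\infty},$$ $$\sum_{n=0}^{\infty}\Bigl(\sum_{d\mid5n+1}\chi_{4,5}(d)\Bigr)q^n=\frac{(q;q)_\infty(q^5;q^5)_\infty}{(q;q^5)_\infty^3(q^4;q^5)_\infty^3}.$$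
   Context: $(a;q)_\infty=\prod_{k\ge0}(1-aq^k)$. Sums over $d\mid N$ run over the positive divisors of $N$. *)

theory Defs
  imports "HOL-Analysis.Analysis" "HOL-Computational_Algebra.Primes"
begin

definition dirichlet_character :: "nat \<Rightarrow> (int \<Rightarrow> complex) \<Rightarrow> bool" where
  "dirichlet_character m c \<longleftrightarrow>
     (\<forall>a. c (a + int m) = c a) \<and>
     (\<forall>a b. c (a * b) = c a * c b) \<and>
     (\<forall>a. c a \<noteq> 0 \<longleftrightarrow> coprime a (int m))"

definition chi45 :: "int \<Rightarrow> complex" where
  "chi45 a = (if a mod 5 = 1 then 1
              else if a mod 5 = 2 then - \<i>
              else if a mod 5 = 3 then \<i>
              else if a mod 5 = 4 then - 1
              else 0)"

lemma dirichlet_character_chi45: "dirichlet_character 5 chi45"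
proof -
  have cases5: "a mod 5 = 0 \<or> a mod 5 = 1 \<or> a mod 5 = 2 \<or> a mod 5 = 3 \<or> a mod 5 = 4"
    for a :: int by presburger
  have "chi45 (a * b) = chi45 a * chi45 b" for a b
  proof -
    have "(a * b) mod 5 = ((a mod 5) * (b mod 5)) mod 5"
      by (simp only: mod_mult_eq)
    then show ?thesis
      using cases5[of a] cases5[of b] by (elim disjE) (simp_all add: chi45_def)
  qed
  moreover have "chi45 a \<noteq> 0 \<longleftrightarrow> coprime a 5" for a
  proof -
    have "coprime a 5 \<longleftrightarrow> \<not> 5 dvd a"
      using prime_imp_coprime[of "5::int" a] coprime_common_divisor[of a 5 5]
      by (auto simp: coprime_commute)
    then show ?thesis
      using cases5[of a] by (auto simp: chi45_def dvd_eq_mod_eq_0)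
  qed
  ultimately show ?thesis
    by (simp add: dirichlet_character_def chi45_def)
qed

definition qpoch :: "complex \<Rightarrow> complex \<Rightarrow> complex" where
  "qpoch a q = (\<Prod>k. 1 - a * q ^ k)"

lemma convergent_prod_qpoch:
  fixes a q :: complex
  assumes "norm q < 1"
  shows "convergent_prod (\<lambda>k. 1 - a * q ^ k)"
proof -
  have "summable (\<lambda>k. norm a * norm q ^ k)"
    using assms by (intro summable_mult summable_geometric) simp
  moreover have "norm ((1 - a * q ^ k) - 1) = norm a * norm q ^ k" for k
    using norm_mult[of a "q ^ k"] norm_power[of q k] by simp
  ultimately have "summable (\<lambda>k. norm ((1 - a * q ^ k) - 1))"
    by presburger
  then have "abs_convergent_prod (\<lambda>k. 1 - a * q ^ k)"
    by (rule summable_imp_abs_convergent_prod)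
  then show ?thesis
    by (rule abs_convergent_prod_imp_convergent_prod)
qed

end

theory Submission
  imports Defs "HOL-Computational_Algebra.Polynomial"
begin

text \<open>
  A divisor \<open>d\<close> of \<open>m = 5n + r\<close> with \<open>d\<close> congruent to \<open>b\<close> modulo \<open>5\<close> has a cofactor in the
  residue class \<open>a\<close> with \<open>ab\<close> congruent to \<open>r\<close>. The character is odd, and exchanging a divisor
  with its cofactor makes the remaining classes cancel or merge, so the divisor sum is a constant
  times the number of factorisations \<open>m = (5k + b)(5l + a)\<close> minus the number of factorisations
  \<open>m = (5k + 5 - b)(5l + 5 - a)\<close>, with \<open>(a, b)\<close> one of \<open>(2, 2)\<close>, \<open>(1, 3)\<close>, \<open>(1, 2)\<close>, \<open>(1, 1)\<close>.
  The generating function of this difference is the bilateral Lambert series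
  \<open>\<Sum> y\<^sup>k / (1 - x p\<^sup>k)\<close> over all integers \<open>k\<close>, with \<open>p = q\<^sup>5\<close>, \<open>x = q\<^sup>b\<close>, \<open>y = q\<^sup>a\<close>, which
  Kronecker's identity (a case of Ramanujan's summation of the bilateral series 1-psi-1) turns into
  a product. Kronecker's identity is the limit of the partial fraction expansion in \<open>x\<close> of a
  quotient of finite products with poles at \<open>p\<^sup>k\<close>, \<open>-N \<le> k \<le> N\<close>.
\<close>

subsection \<open>Finite and infinite q-Pochhammer symbols\<close>

definition qpochn :: "complex \<Rightarrow> complex \<Rightarrow> nat \<Rightarrow> complex" where
  "qpochn a q n = (\<Prod>k<n. 1 - a * q ^ k)"

lemma qpochn_add: "qpochn a q (m + n) = qpochn a q m * qpochn (a * q ^ m) q n"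
  by (induction n) (simp_all add: qpochn_def power_add mult_ac)

lemma LIMSEQ_qpochn:
  assumes "norm q < 1"
  shows "(\<lambda>n. qpochn a q n) \<longlonglongrightarrow> qpoch a q"
proof -
  have "(\<lambda>n. qpochn a q (Suc n)) \<longlonglongrightarrow> qpoch a q"
    unfolding qpochn_def qpoch_def lessThan_Suc_atMost
    by (intro convergent_prod_LIMSEQ convergent_prod_qpoch assms)
  then show ?thesis
    by (simp add: filterlim_sequentially_Suc)
qed

lemma qpoch_factor_nonzero:
  fixes a q :: complex
  assumes "norm a < 1" "norm q < 1"
  shows "1 - a * q ^ k \<noteq> 0"
proof -
  have "norm (a * q ^ k) \<le> norm a * 1"
    unfolding norm_mult norm_power using assms
    by (intro mult_left_mono power_le_one) auto
  with assms(1) have "a * q ^ k \<noteq> 1" by auto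
  then show ?thesis by simp
qed

lemma qpoch_nonzero: "norm a < 1 \<Longrightarrow> norm q < 1 \<Longrightarrow> qpoch a q \<noteq> 0"
  unfolding qpoch_def
  using prodinf_nonzero[OF convergent_prod_qpoch[of q a]] qpoch_factor_nonzero[of a q] by blast

lemma qpochn_nonzero: "norm a < 1 \<Longrightarrow> norm q < 1 \<Longrightarrow> qpochn a q n \<noteq> 0"
  using qpoch_factor_nonzero[of a q] by (simp add: qpochn_def)

lemma qpoch_0_left [simp]: "qpoch 0 q = 1"
  by (simp add: qpoch_def)

text \<open>Sorting the factors 1 - q^j, 1 \<le> j \<le> n m, by the residue of j modulo m proves
  the identity for finite products; then n tends to infinity.\<close>

lemma qpoch_multisection:
  assumes "norm q < 1" "m > 0"
  shows "qpoch q q = (\<Prod>r=1..m. qpoch (q ^ r) (q ^ m))"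
proof (rule LIMSEQ_unique)
  have nm: "norm (q ^ m) < 1"
    using assms by (simp add: norm_power power_less_one_iff)
  have eq: "qpochn q q (n * m) = (\<Prod>r=1..m. qpochn (q ^ r) (q ^ m) n)" for n
  proof -
    have "qpochn q q (n * m) = (\<Prod>k<n. \<Prod>r=k*m..<k*m+m. 1 - q * q ^ r)"
      unfolding qpochn_def by (simp add: prod.nat_group)
    also have "\<dots> = (\<Prod>k<n. \<Prod>r<m. 1 - q ^ Suc r * (q ^ m) ^ k)"
    proof (rule prod.cong[OF refl])
      fix k
      show "(\<Prod>r=k*m..<k*m+m. 1 - q * q ^ r) = (\<Prod>r<m. 1 - q ^ Suc r * (q ^ m) ^ k)"
        by (intro prod.reindex_bij_witness[of _ "\<lambda>r. k * m + r" "\<lambda>r. r - k * m"])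
          (auto simp: mult_ac simp flip: power_mult power_add power_Suc)
    qed
    also have "\<dots> = (\<Prod>r<m. \<Prod>k<n. 1 - q ^ Suc r * (q ^ m) ^ k)"
      by (rule prod.swap)
    also have "\<dots> = (\<Prod>r=1..m. qpochn (q ^ r) (q ^ m) n)"
      unfolding qpochn_def
      by (rule prod.reindex_bij_witness[of _ "\<lambda>r. r - 1" Suc]) auto
    finally show ?thesis .
  qed
  show "(\<lambda>n. qpochn q q (n * m)) \<longlonglongrightarrow> qpoch q q"
    by (rule filterlim_compose[OF LIMSEQ_qpochn[OF assms(1)]]) (use assms(2) in \<open>simp add: mult_nat_right_at_top\<close>)
  show "(\<lambda>n. qpochn q q (n * m)) \<longlonglongrightarrow> (\<Prod>r=1..m. qpoch (q ^ r) (q ^ m))"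
    unfolding eq by (intro tendsto_prod LIMSEQ_qpochn nm)
qed

subsection \<open>Partial fractions\<close>

text \<open>Lagrange interpolation: after clearing denominators both sides are polynomials in x of
  degree less than \<open>card I\<close>, and they agree at the \<open>card I\<close> distinct
  points 1 / \<open>c i\<close>.\<close>

lemma partial_fractions:
  fixes c :: "'a \<Rightarrow> complex" and d :: "'b \<Rightarrow> complex"
  assumes fin: "finite I" "finite J" and "card J < card I" and inj: "inj_on c I"
    and nz: "\<And>i. i \<in> I \<Longrightarrow> c i \<noteq> 0" "\<And>i. i \<in> I \<Longrightarrow> x * c i \<noteq> 1"
  shows "(\<Prod>j\<in>J. 1 - x * d j) / (\<Prod>i\<in>I. 1 - x * c i) =
    (\<Sum>i\<in>I. (\<Prod>j\<in>J. 1 - d j / c i) / (\<Prod>j\<in>I - {i}. 1 - c j / c i) / (1 - x * c i))"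
proof -
  define B where "B i = (\<Prod>j\<in>J. 1 - d j / c i) / (\<Prod>j\<in>I - {i}. 1 - c j / c i)" for i
  define P where "P = (\<Prod>j\<in>J. [:1, - d j:])"
  define Q where "Q = (\<Sum>i\<in>I. smult (B i) (\<Prod>j\<in>I - {i}. [:1, - c j:]))"
  have P: "poly P z = (\<Prod>j\<in>J. 1 - z * d j)" for z
    by (simp add: P_def poly_prod)
  have Q: "poly Q z = (\<Sum>i\<in>I. B i * (\<Prod>j\<in>I - {i}. 1 - z * c j))" for z
    by (simp add: Q_def poly_prod poly_sum)
  have deg: "degree (\<Prod>j\<in>K. [:1, - f j:]) \<le> card K" if "finite K" for K and f :: "'c \<Rightarrow> complex"
  proof -
    have "degree (\<Prod>j\<in>K. [:1, - f j:]) \<le> (\<Sum>j\<in>K. degree [:1, - f j:])"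
      using degree_prod_sum_le[OF that, of "\<lambda>j. [:1, - f j:]"] by (simp only: o_def)
    also have "\<dots> \<le> (\<Sum>j\<in>K. 1)"
      by (rule sum_mono) simp
    finally show ?thesis by simp
  qed
  have "P = Q"
  proof (rule poly_eqI_degree)
    fix z assume "z \<in> (\<lambda>i. inverse (c i)) ` I"
    then obtain i where i: "i \<in> I" "z = inverse (c i)" by auto
    \<comment> \<open>At z = 1 / \<open>c i\<close> every summand with k \<noteq> i contains the
      vanishing factor 1 - z \<open>c i\<close>.\<close>
    have "poly Q z = (\<Sum>k\<in>I. if k = i then B i * (\<Prod>j\<in>I - {i}. 1 - z * c j) else 0)"
      unfolding Q
    proof (intro sum.cong refl)
      fix k assume "k \<in> I"
      have "(\<Prod>j\<in>I - {k}. 1 - z * c j) = 0" if "k \<noteq> i"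
        using that i fin nz by (intro prod_zero) (auto intro!: bexI[of _ i])
      then show "B k * (\<Prod>j\<in>I - {k}. 1 - z * c j) =
          (if k = i then B i * (\<Prod>j\<in>I - {i}. 1 - z * c j) else 0)" by auto
    qed
    also have "\<dots> = B i * (\<Prod>j\<in>I - {i}. 1 - c j / c i)"
      using i fin by (simp add: field_simps)
    also have "\<dots> = (\<Prod>j\<in>J. 1 - d j / c i)"
    proof -
      have "(\<Prod>j\<in>I - {i}. 1 - c j / c i) \<noteq> 0"
        using i inj fin nz by (auto simp: inj_on_def)
      then show ?thesis by (simp add: B_def)
    qed
    also have "\<dots> = poly P z"
      by (simp add: P i field_simps)
    finally show "poly P z = poly Q z" by simp
  next
    have card: "card ((\<lambda>i. inverse (c i)) ` I) = card I"
      using inj by (intro card_image) (auto simp: inj_on_def)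
    show "card ((\<lambda>i. inverse (c i)) ` I) > degree P"
      using deg[OF fin(2), of d] assms(3) unfolding card P_def by linarith
    have "degree Q \<le> card I - 1"
      unfolding Q_def
    proof (intro degree_sum_le fin(1))
      fix i assume "i \<in> I"
      then show "degree (smult (B i) (\<Prod>j\<in>I - {i}. [:1, - c j:])) \<le> card I - 1"
        using deg[of "I - {i}" c] fin degree_smult_le[of "B i" "\<Prod>j\<in>I - {i}. [:1, - c j:]"]
        by simp
    qed
    with assms(3) show "card ((\<lambda>i. inverse (c i)) ` I) > degree Q"
      unfolding card by linarith
  qed
  then have "(\<Prod>j\<in>J. 1 - x * d j) = (\<Sum>i\<in>I. B i * (\<Prod>j\<in>I - {i}. 1 - x * c j))"
    by (simp flip: P Q)
  also have "\<dots> = (\<Sum>i\<in>I. B i / (1 - x * c i) * (\<Prod>i\<in>I. 1 - x * c i))"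
  proof (intro sum.cong refl)
    fix i assume i: "i \<in> I"
    with nz(2)[OF i] fin show "B i * (\<Prod>j\<in>I - {i}. 1 - x * c j) =
        B i / (1 - x * c i) * (\<Prod>i\<in>I. 1 - x * c i)"
      by (simp add: prod.remove[OF fin(1) i])
  qed
  also have "\<dots> = (\<Sum>i\<in>I. B i / (1 - x * c i)) * (\<Prod>i\<in>I. 1 - x * c i)"
    by (simp add: sum_distrib_right)
  finally show ?thesis
    using nz(2) fin by (simp add: B_def)
qed

text \<open>Read backwards, the factors are 1 - y / p^(i+1), and each is -y / p^(i+1) times 1 -
  p^(i+1) / y. This trades negative powers of p for positive ones, so that m can tend to
  infinity.\<close>

lemma prod_reflect:
  assumes "p \<noteq> 0" "y \<noteq> 0"
  shows "(\<Prod>j<m. 1 - y * p ^ j / p ^ m) = (- y) ^ m / (\<Prod>i<m. p ^ Suc i) * qpochn (p / y) p m"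
proof -
  have "(\<Prod>j<m. 1 - y * p ^ j / p ^ m) = (\<Prod>i<m. 1 - y * p ^ (m - Suc i) / p ^ m)"
    by (rule prod.nat_diff_reindex[symmetric])
  also have "\<dots> = (\<Prod>i<m. - y / p ^ Suc i * (1 - p / y * p ^ i))"
  proof (intro prod.cong refl)
    fix i assume "i \<in> {..<m}"
    then have "p ^ m = p ^ (m - Suc i) * p ^ Suc i"
      by (simp flip: power_add power_Suc)
    with assms show "1 - y * p ^ (m - Suc i) / p ^ m = - y / p ^ Suc i * (1 - p / y * p ^ i)"
      by (simp add: field_simps)
  qed
  also have "\<dots> = (- y) ^ m / (\<Prod>i<m. p ^ Suc i) * qpochn (p / y) p m"
    by (simp only: prod.distrib prod_dividef qpochn_def prod_constant card_lessThan)
  finally show ?thesis .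
qed

lemma power_neq_1: "norm (p :: complex) < 1 \<Longrightarrow> n > 0 \<Longrightarrow> p ^ n \<noteq> 1"
  by (metis norm_one norm_power power_less_one_iff less_irrefl norm_ge_zero)

text \<open>Partial fractions in u with simple poles at p^(-m). In the coefficient at m both
  products split at j = m: the factors below are reflected, those from there on already form
  Pochhammer symbols.\<close>

lemma qpochn_partial_fractions:
  fixes p u y :: complex
  assumes p: "p \<noteq> 0" "norm p < 1" and y: "y \<noteq> 0" and u: "\<And>k. k \<le> M \<Longrightarrow> u * p ^ k \<noteq> 1"
  shows "qpochn (u * y) p M / qpochn u p (Suc M) =
    (\<Sum>m\<le>M. y ^ m * (qpochn (p / y) p m * qpochn y p (M - m) /
      (qpochn p p m * qpochn p p (M - m))) / (1 - u * p ^ m))"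
proof -
  have inj: "inj_on (\<lambda>k. p ^ k) {..M}"
  proof (rule inj_onI)
    fix i j assume eq: "p ^ i = p ^ j"
    have "p ^ i \<noteq> p ^ j" if "i < j" for i j
    proof
      assume "p ^ i = p ^ j"
      also have "p ^ j = p ^ i * p ^ (j - i)" using that by (simp flip: power_add)
      finally show False using p power_neq_1[of p "j - i"] that by simp
    qed
    with eq show "i = j" by (metis linorder_neqE_nat)
  qed
  have "qpochn (u * y) p M / qpochn u p (Suc M) =
      (\<Prod>j<M. 1 - u * (y * p ^ j)) / (\<Prod>i\<le>M. 1 - u * p ^ i)"
    by (simp only: qpochn_def lessThan_Suc_atMost mult.assoc)
  also have "\<dots> = (\<Sum>m\<le>M. (\<Prod>j<M. 1 - y * p ^ j / p ^ m) /
      (\<Prod>j\<in>{..M} - {m}. 1 - p ^ j / p ^ m) / (1 - u * p ^ m))"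
    using p u by (intro partial_fractions inj) auto
  also have "\<dots> = (\<Sum>m\<le>M. y ^ m * (qpochn (p / y) p m * qpochn y p (M - m) /
      (qpochn p p m * qpochn p p (M - m))) / (1 - u * p ^ m))"
  proof (intro sum.cong refl arg_cong2[where f = "(/)"])
    fix m assume "m \<in> {..M}"
    then have m: "m \<le> M" by simp
    have "(\<Prod>j<M. 1 - y * p ^ j / p ^ m) =
        (\<Prod>j<m. 1 - y * p ^ j / p ^ m) * (\<Prod>j=m..<M. 1 - y * p ^ j / p ^ m)"
      using m by (simp add: lessThan_atLeast0 prod.atLeastLessThan_concat)
    also have "(\<Prod>j=m..<M. 1 - y * p ^ j / p ^ m) = qpochn y p (M - m)"
      unfolding qpochn_def using m p
      by (intro prod.reindex_bij_witness[of _ "\<lambda>j. j + m" "\<lambda>j. j - m"])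
        (auto simp: power_diff)
    finally have num: "(\<Prod>j<M. 1 - y * p ^ j / p ^ m) =
      (- y) ^ m / (\<Prod>i<m. p ^ Suc i) * qpochn (p / y) p m * qpochn y p (M - m)"
      by (simp only: prod_reflect[OF p(1) y])
    \<comment> \<open>The factors below m are those of \<open>prod_reflect\<close> at y = 1.\<close>
    have "{..M} - {m} = {..<m} \<union> {m<..M}" using m by auto
    then have "(\<Prod>j\<in>{..M} - {m}. 1 - p ^ j / p ^ m) =
        (\<Prod>j<m. 1 - 1 * p ^ j / p ^ m) * (\<Prod>j\<in>{m<..M}. 1 - p ^ j / p ^ m)"
      by (simp add: prod.union_disjoint disjoint_iff)
    also have "(\<Prod>j\<in>{m<..M}. 1 - p ^ j / p ^ m) = qpochn p p (M - m)"
      unfolding qpochn_def using m p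
      by (intro prod.reindex_bij_witness[of _ "\<lambda>j. j + Suc m" "\<lambda>j. j - Suc m"])
        (auto simp: power_diff field_simps)
    finally have den: "(\<Prod>j\<in>{..M} - {m}. 1 - p ^ j / p ^ m) =
      (- 1) ^ m / (\<Prod>i<m. p ^ Suc i) * qpochn p p m * qpochn p p (M - m)"
      using prod_reflect[OF p(1), of 1 m] by simp
    \<comment> \<open>This product occurs in both \<open>num\<close> and \<open>den\<close> and
      cancels; the quotient of (-y)^m and (-1)^m leaves y^m.\<close>
    have "(\<Prod>i<m. p ^ Suc i) \<noteq> 0" using p by auto
    then show "(\<Prod>j<M. 1 - y * p ^ j / p ^ m) / (\<Prod>j\<in>{..M} - {m}. 1 - p ^ j / p ^ m) =
      y ^ m * (qpochn (p / y) p m * qpochn y p (M - m) / (qpochn p p m * qpochn p p (M - m)))"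
      unfolding num den
      using qpochn_nonzero[OF p(2) p(2)] by (subst power_minus) (simp add: divide_simps)
  qed
  finally show ?thesis .
qed

subsection \<open>Kronecker's identity\<close>

text \<open>Tannery's theorem for truncated sums: terms beyond \<open>g n\<close> are set to zero,
  and K |w k| dominates. Since L does not depend on k, it factors out of the limit.\<close>

lemma tendsto_sum_dominated:
  fixes w :: "nat \<Rightarrow> complex" and B :: "nat \<Rightarrow> nat \<Rightarrow> complex"
  assumes w: "summable (\<lambda>k. norm (w k))"
    and lim: "\<And>k. (\<lambda>n. B k n) \<longlonglongrightarrow> L"
    and bound: "\<And>k n. norm (B k n) \<le> K"
    and g: "filterlim g at_top sequentially"
  shows "(\<lambda>n. \<Sum>k<g n. w k * B k n) \<longlonglongrightarrow> L * suminf w"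
proof -
  define a where "a k n = (if k < g n then w k * B k n else 0)" for k n
  have "0 \<le> K" using bound norm_ge_zero order_trans by blast
  have "(\<lambda>n. a k n) \<longlonglongrightarrow> w k * L" for k
  proof (rule Lim_transform_eventually)
    show "(\<lambda>n. w k * B k n) \<longlonglongrightarrow> w k * L"
      by (intro tendsto_intros lim)
    have "eventually (\<lambda>n. k < g n) sequentially"
      using g unfolding filterlim_at_top by (auto simp: Suc_le_eq dest!: spec[of _ "Suc k"])
    then show "\<forall>\<^sub>F n in sequentially. w k * B k n = a k n"
      by eventually_elim (simp add: a_def)
  qed
  moreover have "norm (a k n) \<le> norm (w k) * K" for k n
    using bound[of k n] \<open>0 \<le> K\<close> by (auto simp: a_def norm_mult intro!: mult_left_mono)
  then have "\<forall>\<^sub>F (k, n) in at_top \<times>\<^sub>F sequentially. norm (a k n) \<le> norm (w k) * K"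
    by (intro always_eventually) auto
  moreover have "summable (\<lambda>k. norm (w k) * K)"
    by (intro summable_mult2 w)
  ultimately have "(\<lambda>n. suminf (\<lambda>k. a k n)) \<longlonglongrightarrow> suminf (\<lambda>k. w k * L)"
    using tannerys_theorem[of a "\<lambda>k. w k * L" sequentially "\<lambda>k. norm (w k) * K"] by auto
  moreover have "suminf (\<lambda>k. a k n) = (\<Sum>k<g n. w k * B k n)" for n
    by (subst suminf_finite[of "{..<g n}"]) (auto simp: a_def)
  moreover have "suminf (\<lambda>k. w k * L) = L * suminf w"
    using suminf_mult2[OF summable_norm_cancel[OF w], of L] by (simp only: mult.commute[of L])
  ultimately show ?thesis by simp
qed

text \<open>Since p^k tends to 0, the numbers 1 / (1 - x p^k) converge to 1 and are bounded (a
  vanishing denominator gives 0), so a geometric series in |z| dominates.\<close>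

lemma summable_lambert:
  fixes z x p :: complex
  assumes "norm z < 1" "norm p < 1"
  shows "summable (\<lambda>k. norm (z ^ k / (1 - x * p ^ k)))"
proof -
  have "(\<lambda>k. inverse (1 - x * p ^ k)) \<longlonglongrightarrow> inverse (1 - x * 0)"
    using assms by (intro tendsto_intros LIMSEQ_power_zero) auto
  then have "Bseq (\<lambda>k. inverse (1 - x * p ^ k))"
    by (intro convergent_imp_Bseq) (auto simp: convergent_def)
  then obtain C where C: "\<And>k. norm (inverse (1 - x * p ^ k)) \<le> C"
    by (auto simp: Bseq_def)
  show ?thesis
  proof (rule summable_comparison_test')
    show "summable (\<lambda>k. norm z ^ k * C)"
      using assms by (intro summable_mult2 summable_geometric) auto
    show "norm (norm (z ^ k / (1 - x * p ^ k))) \<le> norm z ^ k * C" for k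
      using C[of k] by (simp add: divide_inverse norm_mult norm_power mult_left_mono)
  qed
qed

lemma Bseq_qpochn_ratio:
  assumes "norm p < 1"
  shows "Bseq (\<lambda>n. qpochn a p n / qpochn p p n)"
proof (rule convergent_imp_Bseq)
  have "(\<lambda>n. qpochn a p n / qpochn p p n) \<longlonglongrightarrow> qpoch a p / qpoch p p"
    using assms by (intro tendsto_intros LIMSEQ_qpochn qpoch_nonzero)
  then show "convergent (\<lambda>n. qpochn a p n / qpochn p p n)"
    by (auto simp: convergent_def)
qed

text \<open>Taking u = x / p^N puts the poles in x at p^k, -N \<le> k \<le> N. The first N factors
  of numerator and denominator are reflected, and their prefactors (-x y)^N and (-x)^N leave
  y^N.\<close>

lemma symmetric_qpochn_ratio:
  fixes p x y :: complex
  assumes p: "p \<noteq> 0" and xy: "x \<noteq> 0" "y \<noteq> 0"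
  shows "qpochn (x / p ^ N * y) p (2 * N) / qpochn (x / p ^ N) p (Suc (2 * N)) =
    y ^ N * (qpochn (p / (x * y)) p N * qpochn (x * y) p N /
      (qpochn (p / x) p N * qpochn x p (Suc N)))"
proof -
  have refl: "qpochn (z / p ^ N) p N = (- z) ^ N / (\<Prod>i<N. p ^ Suc i) * qpochn (p / z) p N"
    if "z \<noteq> 0" for z
    using prod_reflect[OF p that, of N] by (simp add: qpochn_def)
  have nz: "(\<Prod>i<N. p ^ Suc i) \<noteq> 0" using p by auto
  have "qpochn (x / p ^ N * y) p (2 * N) = qpochn (x * y / p ^ N) p N * qpochn (x * y) p N"
    using p qpochn_add[of "x * y / p ^ N" p N N] by (simp add: mult_2)
  moreover have "qpochn (x / p ^ N) p (Suc (2 * N)) = qpochn (x / p ^ N) p N * qpochn x p (Suc N)"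
    using p qpochn_add[of "x / p ^ N" p N "Suc N"] by (simp add: mult_2)
  moreover have "(- (x * y)) ^ N = (- x) ^ N * y ^ N"
    by (simp flip: power_mult_distrib)
  ultimately show ?thesis
    using refl[OF xy(1)] refl[of "x * y"] xy nz by simp
qed

lemma sum_recentre:
  fixes f :: "nat \<Rightarrow> complex"
  shows "(\<Sum>m\<le>2 * N. f m) = (\<Sum>k<Suc N. f (N + k)) + (\<Sum>k<N. f (N - Suc k))"
proof -
  have "(\<Sum>m\<le>2 * N. f m) = sum f {0..<N + Suc N}"
    by (intro sum.cong) auto
  also have "\<dots> = sum f {0..<N} + sum f {N..<N + Suc N}"
    by (intro sum.atLeastLessThan_concat[symmetric]) auto
  also have "sum f {0..<N} = (\<Sum>k<N. f (N - Suc k))"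
    by (simp only: lessThan_atLeast0[symmetric] sum.nat_diff_reindex[of f])
  also have "sum f {N..<N + Suc N} = (\<Sum>k<Suc N. f (N + k))"
    by (rule sum.reindex_bij_witness[of _ "\<lambda>k. N + k" "\<lambda>m. m - N"]) auto
  finally show ?thesis by simp
qed

text \<open>The bracket is the bilateral series of y^k / (1 - x p^k): its term at -(k+1) equals
  -p/(x y) times (p/y)^k / (1 - (p/x) p^k). The bounds on y make both halves converge, those on x
  keep x off the poles p^k.\<close>

lemma kronecker_identity:
  fixes p x y :: complex
  assumes p: "p \<noteq> 0" "norm p < 1"
    and x: "norm p < norm x" "norm x < 1" and y: "norm p < norm y" "norm y < 1"
  shows "qpoch (x * y) p * qpoch (p / (x * y)) p / (qpoch x p * qpoch (p / x) p) =
    qpoch y p * qpoch (p / y) p / qpoch p p ^ 2 *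
      ((\<Sum>k. y ^ k / (1 - x * p ^ k)) - p / (x * y) * (\<Sum>k. (p / y) ^ k / (1 - p / x * p ^ k)))"
    (is "?lhs = ?L * (suminf ?w1 - p / (x * y) * suminf ?w2)")
proof (rule LIMSEQ_unique)
  have xy0: "x \<noteq> 0" "y \<noteq> 0" using x y by auto
  have px: "norm (p / x) < 1" and py: "norm (p / y) < 1"
    using x y xy0 by (simp_all add: norm_divide)
  \<comment> \<open>Coefficient of the finite expansion without its power of y; it is bounded, and
    tends to \<open>?L\<close> when both indices tend to infinity.\<close>
  define B where "B m n = (qpochn (p / y) p m / qpochn p p m) * (qpochn y p n / qpochn p p n)" for m n
  define F where "F N = qpochn (p / (x * y)) p N * qpochn (x * y) p N /
      (qpochn (p / x) p N * qpochn x p (Suc N))" for N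
  show "F \<longlonglongrightarrow> ?lhs"
  proof -
    have "F \<longlonglongrightarrow> qpoch (p / (x * y)) p * qpoch (x * y) p / (qpoch (p / x) p * qpoch x p)"
      unfolding F_def using p x px
      by (intro tendsto_intros LIMSEQ_qpochn filterlim_sequentially_Suc[THEN iffD2])
        (auto simp: qpoch_nonzero)
    then show ?thesis by (simp add: mult.commute)
  qed
  obtain K1 K2 where K: "\<And>n. norm (qpochn (p / y) p n / qpochn p p n) \<le> K1"
      "\<And>n. norm (qpochn y p n / qpochn p p n) \<le> K2"
    using Bseq_qpochn_ratio[OF p(2)] unfolding Bseq_def by metis
  have bound: "norm (B m n) \<le> K1 * K2" for m n
    unfolding B_def norm_mult
    by (intro mult_mono K norm_ge_zero order_trans[OF norm_ge_zero K(1)])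
  have lim: "(\<lambda>N. B (f N) (g N)) \<longlonglongrightarrow> ?L"
    if "filterlim f at_top sequentially" "filterlim g at_top sequentially" for f g
  proof -
    have "(\<lambda>N. B (f N) (g N)) \<longlonglongrightarrow> (qpoch (p / y) p / qpoch p p) * (qpoch y p / qpoch p p)"
      unfolding B_def using p
      by (intro tendsto_intros filterlim_compose[OF LIMSEQ_qpochn that(1)]
          filterlim_compose[OF LIMSEQ_qpochn that(2)] qpoch_nonzero) auto
    then show ?thesis by (simp add: power2_eq_square mult.commute)
  qed
  \<comment> \<open>Expand at u = x / p^N with M = 2N, divide by y^N and centre the summation index
    at N.\<close>
  have eq: "F N = (\<Sum>k<Suc N. ?w1 k * B (N + k) (N - k)) -
      p / (x * y) * (\<Sum>k<N. ?w2 k * B (N - Suc k) (Suc (N + k)))" for N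
  proof -
    \<comment> \<open>Equality would mean x = p^(N-k): for k < N this forces |x| \<le> |p|,
      otherwise |x| \<ge> 1.\<close>
    have u: "x / p ^ N * p ^ k \<noteq> 1" for k
    proof
      assume "x / p ^ N * p ^ k = 1"
      then have e: "x * p ^ k = p ^ N" using p by (simp add: field_simps)
      show False
      proof (cases "k < N")
        case True
        then have "p ^ N = p ^ (N - k) * p ^ k" by (simp flip: power_add)
        with e p have "x = p ^ (N - k)" by simp
        then have "norm x = norm p ^ (N - k)" by (simp add: norm_power)
        also have "\<dots> \<le> norm p ^ 1"
          using p True by (intro power_decreasing) auto
        finally show False using x by simp
      next
        case False
        then have "p ^ k = p ^ (k - N) * p ^ N" by (simp flip: power_add)
        with e p have "x * p ^ (k - N) = 1" by simp
        then have "norm x * norm p ^ (k - N) = 1" by (metis norm_mult norm_power norm_one)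
        moreover have "norm x * norm p ^ (k - N) \<le> norm x * 1"
          using p by (intro mult_left_mono power_le_one) auto
        ultimately show False using x by simp
      qed
    qed
    have "y ^ N * F N = (\<Sum>m\<le>2 * N. y ^ m * (qpochn (p / y) p m * qpochn y p (2 * N - m) /
      (qpochn p p m * qpochn p p (2 * N - m))) / (1 - x / p ^ N * p ^ m))"
      unfolding F_def symmetric_qpochn_ratio[OF p(1) xy0, symmetric]
      by (rule qpochn_partial_fractions[OF p xy0(2) u])
    also have "\<dots> = (\<Sum>m\<le>2 * N. y ^ m * B m (2 * N - m) / (1 - x / p ^ N * p ^ m))"
      by (simp add: B_def)
    also have "\<dots> = (\<Sum>k<Suc N. y ^ (N + k) * B (N + k) (2 * N - (N + k)) / (1 - x / p ^ N * p ^ (N + k)))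
       + (\<Sum>k<N. y ^ (N - Suc k) * B (N - Suc k) (2 * N - (N - Suc k)) / (1 - x / p ^ N * p ^ (N - Suc k)))"
      by (rule sum_recentre)
    also have "(\<Sum>k<Suc N. y ^ (N + k) * B (N + k) (2 * N - (N + k)) / (1 - x / p ^ N * p ^ (N + k)))
        = (\<Sum>k<Suc N. y ^ N * (?w1 k * B (N + k) (N - k)))"
      using p by (intro sum.cong refl) (simp add: power_add mult_2)
    also have "(\<Sum>k<N. y ^ (N - Suc k) * B (N - Suc k) (2 * N - (N - Suc k)) / (1 - x / p ^ N * p ^ (N - Suc k)))
        = (\<Sum>k<N. y ^ N * (- (p / (x * y)) * (?w2 k * B (N - Suc k) (Suc (N + k)))))"
    proof (intro sum.cong refl)
      \<comment> \<open>The index N - 1 - k lies k + 1 places below the centre, so this is the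
        bilateral term at -(k+1).\<close>
      fix k assume "k \<in> {..<N}"
      then have k: "k < N" by simp
      have yN: "y ^ N = y ^ (N - Suc k) * (y * y ^ k)" and pN: "p ^ N = p ^ (N - Suc k) * (p * p ^ k)"
        using k by (simp_all flip: power_add power_Suc)
      have i: "2 * N - (N - Suc k) = Suc (N + k)" using k by simp
      have "x / p ^ N * p ^ (N - Suc k) \<noteq> 1" by (rule u)
      moreover have e: "x / p ^ N * p ^ (N - Suc k) = x / (p * p ^ k)"
        using p by (simp add: pN)
      ultimately have d: "x \<noteq> p * p ^ k" using p by auto
      have "y ^ (N - Suc k) / (1 - x / (p * p ^ k)) = y ^ N * (- (p / (x * y)) * ?w2 k)"
        using d xy0 p by (simp add: yN divide_simps) (simp add: algebra_simps)
      then have "y ^ (N - Suc k) / (1 - x / (p * p ^ k)) * b = y ^ N * (- (p / (x * y)) * (?w2 k * b))" for b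
        by (simp only: mult.assoc)
      then show "y ^ (N - Suc k) * B (N - Suc k) (2 * N - (N - Suc k)) / (1 - x / p ^ N * p ^ (N - Suc k))
          = y ^ N * (- (p / (x * y)) * (?w2 k * B (N - Suc k) (Suc (N + k))))"
        unfolding e i by (simp only: times_divide_eq_left)
    qed
    finally have "y ^ N * F N = y ^ N * ((\<Sum>k<Suc N. ?w1 k * B (N + k) (N - k)) -
      p / (x * y) * (\<Sum>k<N. ?w2 k * B (N - Suc k) (Suc (N + k))))"
      by (simp only: sum_distrib_left[symmetric] right_diff_distrib) (simp add: algebra_simps)
    then show ?thesis using xy0 by simp
  qed
  \<comment> \<open>Truncated subtraction at k > N is harmless: \<open>bound\<close> holds for all
    indices, and for fixed k the limit sees only large N.\<close>
  have shifts: "filterlim (\<lambda>N. N + k) at_top sequentially" "filterlim (\<lambda>N. N - k) at_top sequentially" for k :: nat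
    by (rule filterlim_add_const_nat_at_top, rule filterlim_minus_const_nat_at_top)
  have "(\<lambda>N. (\<Sum>k<Suc N. ?w1 k * B (N + k) (N - k)) -
      p / (x * y) * (\<Sum>k<N. ?w2 k * B (N - Suc k) (Suc (N + k)))) \<longlonglongrightarrow>
      ?L * suminf ?w1 - p / (x * y) * (?L * suminf ?w2)"
  proof (intro tendsto_diff tendsto_mult tendsto_const)
    show "(\<lambda>N. \<Sum>k<Suc N. ?w1 k * B (N + k) (N - k)) \<longlonglongrightarrow> ?L * suminf ?w1"
      by (rule tendsto_sum_dominated[where g = Suc])
        (auto intro!: summable_lambert lim bound shifts filterlim_Suc simp: p y)
    show "(\<lambda>N. \<Sum>k<N. ?w2 k * B (N - Suc k) (Suc (N + k))) \<longlonglongrightarrow> ?L * suminf ?w2"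
    proof (rule tendsto_sum_dominated[where g = "\<lambda>n. n"])
      show "(\<lambda>N. B (N - Suc k) (Suc (N + k))) \<longlonglongrightarrow> ?L" for k
        using shifts(1)[of "Suc k"] by (intro lim shifts) simp
    qed (rule summable_lambert[OF py p(2)] bound filterlim_ident)+
  qed
  then show "F \<longlonglongrightarrow> ?L * (suminf ?w1 - p / (x * y) * suminf ?w2)"
    unfolding eq[abs_def] by (simp add: algebra_simps)
qed

subsection \<open>Counting factorisations by residue class\<close>

definition rep_pairs :: "nat \<Rightarrow> nat \<Rightarrow> nat \<Rightarrow> (nat \<times> nat) set" where
  "rep_pairs a b m = {(k, l). (5 * k + b) * (5 * l + a) = m}"

lemma rep_pairs_swap: "card (rep_pairs a b m) = card (rep_pairs b a m)"
  by (rule bij_betw_same_card[of prod.swap], rule bij_betwI[of _ _ _ prod.swap])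
    (auto simp: rep_pairs_def mult.commute)

lemma finite_rep_pairs:
  assumes "a > 0" "b > 0"
  shows "finite (rep_pairs a b m)"
proof (rule finite_subset)
  show "rep_pairs a b m \<subseteq> {..m} \<times> {..m}"
  proof (clarsimp simp: rep_pairs_def)
    fix k l
    have "k * 1 \<le> (5 * k + b) * (5 * l + a)" "1 * l \<le> (5 * k + b) * (5 * l + a)"
      using assms by (intro mult_le_mono; simp)+
    then show "k \<le> (5 * k + b) * (5 * l + a) \<and> l \<le> (5 * k + b) * (5 * l + a)" by simp
  qed
qed simp

text \<open>Both sides sum q^(a k + (5k+b) l + c) over all pairs (k, l), where the exponent is the n
  with (5k+b)(5l+a) = 5n + r. Summing over l first gives geometric series; grouping by n gives the
  counts.\<close>

lemma lambert_sums:
  fixes q :: complex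
  assumes q: "norm q < 1" and ab: "a > 0" "b > 0" and r: "a * b = 5 * c + r" "r < 5"
  shows "(\<lambda>n. of_nat (card (rep_pairs a b (5 * n + r))) * q ^ n) sums
    (\<Sum>k. q ^ (a * k + c) / (1 - q ^ (5 * k + b)))"
proof -
  define g where "g = (\<lambda>(k, l). a * k + (5 * k + b) * l + c)"
  have g: "(5 * k + b) * (5 * l + a) = 5 * g (k, l) + r" for k l
    using r by (simp add: g_def algebra_simps)
  define f where "f z = q ^ g z" for z
  have geo: "(\<lambda>n. norm q ^ n) summable_on UNIV"
    using q by (simp add: summable_on_UNIV_nonneg_real_iff summable_geometric)
  \<comment> \<open>As a and b are positive, the exponent is at least k + l, so a product of two
    geometric series dominates and rearrangement is allowed.\<close>
  have "(\<lambda>z. norm (f z)) summable_on UNIV \<times> UNIV"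
  proof (rule summable_on_comparison_test)
    have "(\<lambda>(k, l). norm q ^ k * norm q ^ l) summable_on UNIV \<times> UNIV"
    proof (rule summable_on_SigmaI)
      show "((\<lambda>l. case (k, l) of (k, l) \<Rightarrow> norm q ^ k * norm q ^ l) has_sum
          norm q ^ k * (\<Sum>\<^sub>\<infinity>l. norm q ^ l)) UNIV" for k
        using geo by (auto intro!: has_sum_cmult_right has_sum_infsum)
      show "(\<lambda>k. norm q ^ k * (\<Sum>\<^sub>\<infinity>l. norm q ^ l)) summable_on UNIV"
        by (intro summable_on_cmult_left geo)
    qed auto
    then show "(\<lambda>z. norm q ^ fst z * norm q ^ snd z) summable_on UNIV \<times> UNIV"
      by (simp add: case_prod_unfold)
    show "norm (f z) \<le> norm q ^ fst z * norm q ^ snd z" for z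
    proof -
      have "1 * fst z + 1 * snd z \<le> a * fst z + (5 * fst z + b) * snd z"
        using ab by (intro add_le_mono mult_le_mono1) auto
      then have "fst z + snd z \<le> g z"
        by (simp add: g_def case_prod_unfold)
      then show ?thesis
        using q by (simp add: f_def norm_power power_decreasing flip: power_add)
    qed
  qed auto
  then have "f summable_on UNIV \<times> UNIV"
    by (rule abs_summable_summable)
  then obtain S where S: "(f has_sum S) (UNIV \<times> UNIV)"
    by (auto simp: summable_on_def)
  have "((\<lambda>k. q ^ (a * k + c) / (1 - q ^ (5 * k + b))) has_sum S) UNIV"
  proof (rule has_sum_SigmaD[OF S])
    fix k
    have "norm (q ^ (5 * k + b)) < 1"
      using q ab by (simp add: norm_power power_less_one_iff)
    then have "((\<lambda>l. (q ^ (5 * k + b)) ^ l) has_sum (1 / (1 - q ^ (5 * k + b)))) UNIV"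
      by (intro norm_summable_imp_has_sum geometric_sums) (simp_all add: norm_power summable_geometric)
    then have "((\<lambda>l. q ^ (a * k + c) * (q ^ (5 * k + b)) ^ l) has_sum
        (q ^ (a * k + c) * (1 / (1 - q ^ (5 * k + b))))) UNIV"
      by (rule has_sum_cmult_right)
    moreover have "q ^ (a * k + c) * (q ^ (5 * k + b)) ^ l = f (k, l)" for l
      by (simp only: f_def g_def power_add power_mult split: prod.split) (simp add: mult_ac)
    ultimately show "((\<lambda>l. f (k, l)) has_sum q ^ (a * k + c) / (1 - q ^ (5 * k + b))) UNIV"
      by simp
  qed
  then have S_eq: "(\<Sum>k. q ^ (a * k + c) / (1 - q ^ (5 * k + b))) = S"
    by (intro sums_unique[symmetric] has_sum_imp_sums)
  have fibre: "g -` {n} = rep_pairs a b (5 * n + r)" for n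
    by (auto simp: rep_pairs_def g)
  \<comment> \<open>Tagging each pair with its exponent splits the same double sum into the fibres
    of \<open>g\<close>.\<close>
  have "bij_betw snd (Sigma UNIV (\<lambda>n. g -` {n})) (UNIV \<times> UNIV)"
    by (rule bij_betwI[of _ _ _ "\<lambda>z. (g z, z)"]) auto
  then have "((\<lambda>z. f (snd z)) has_sum S) (Sigma UNIV (\<lambda>n. g -` {n}))"
    using S by (subst has_sum_reindex_bij_betw)
  then have "((\<lambda>n. of_nat (card (rep_pairs a b (5 * n + r))) * q ^ n) has_sum S) UNIV"
  proof (rule has_sum_SigmaD)
    fix n
    have "finite (g -` {n})"
      unfolding fibre using ab by (rule finite_rep_pairs)
    then have "((\<lambda>z. f z) has_sum (\<Sum>z\<in>g -` {n}. f z)) (g -` {n})"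
      by (rule has_sum_finite)
    moreover have "(\<Sum>z\<in>g -` {n}. f z) = (\<Sum>z\<in>g -` {n}. q ^ n)"
      by (rule sum.cong) (auto simp: f_def)
    ultimately show "((\<lambda>z. f (snd (n, z))) has_sum of_nat (card (rep_pairs a b (5 * n + r))) * q ^ n) (g -` {n})"
      by (simp add: fibre)
  qed
  then show ?thesis
    unfolding S_eq by (rule has_sum_imp_sums)
qed

text \<open>The two Lambert series form the bracket of Kronecker's identity at p = q^5, x = q^b, y =
  q^a. For the complementary classes (5-a)(5-b) = 5(5-a-b) + ab, and the offset 5-a-b produces the
  factor p/(x y).\<close>

lemma rep_pairs_diff_sums:
  fixes q :: complex
  assumes q: "norm q < 1" and ab: "a > 0" "b > 0" "a + b \<le> 4" "a * b < 5"
  shows "(\<lambda>n. (of_nat (card (rep_pairs a b (5 * n + a * b))) -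
      of_nat (card (rep_pairs (5 - a) (5 - b) (5 * n + a * b)))) * q ^ n) sums
    (qpoch (q ^ 5) (q ^ 5) ^ 2 * qpoch (q ^ (a + b)) (q ^ 5) * qpoch (q ^ (5 - (a + b))) (q ^ 5) /
     (qpoch (q ^ a) (q ^ 5) * qpoch (q ^ (5 - a)) (q ^ 5) *
      qpoch (q ^ b) (q ^ 5) * qpoch (q ^ (5 - b)) (q ^ 5)))"
    (is "?f sums ?P")
proof -
  define c where "c = 5 - (a + b)"
  let ?W1 = "\<Sum>k. q ^ (a * k) / (1 - q ^ (5 * k + b))"
  let ?W2 = "\<Sum>k. q ^ ((5 - a) * k + c) / (1 - q ^ (5 * k + (5 - b)))"
  have c: "(5 - a) * (5 - b) = 5 * c + a * b"
  proof -
    have "int ((5 - a) * (5 - b)) = int (5 * c + a * b)"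
      using ab by (simp add: c_def of_nat_diff algebra_simps)
    then show ?thesis by linarith
  qed
  have "?f sums (?W1 - ?W2)"
    using sums_diff[OF lambert_sums[OF q, of a b 0 "a * b"]
        lambert_sums[OF q, of "5 - a" "5 - b" c "a * b"]] ab c
    by (simp add: left_diff_distrib)
  moreover have "?W1 - ?W2 = ?P"
  proof (cases "q = 0")
    case True
    \<comment> \<open>Kronecker's identity excludes p = 0. Here both sides are 1: only the term k =
      0 of the first series survives, because 0^0 = 1 and c > 0.\<close>
    have "(\<lambda>k. q ^ (a * k) / (1 - q ^ (5 * k + b))) = (\<lambda>k. if k = 0 then 1 else 0)"
      using True ab by (auto simp: power_0_left)
    moreover have "(\<lambda>k. q ^ ((5 - a) * k + c) / (1 - q ^ (5 * k + (5 - b)))) = (\<lambda>k. 0)"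
      using True ab by (auto simp: power_0_left c_def)
    moreover have "(\<Sum>k::nat. if k = 0 then 1 else 0 :: complex) = 1"
      using sums_single[of 0 "\<lambda>_. 1 :: complex"] by (simp add: sums_iff)
    ultimately show ?thesis
      using True ab by (simp add: power_0_left)
  next
    case False
    define p x y where "p = q ^ 5" and "x = q ^ b" and "y = q ^ a"
    have less: "norm q ^ i < norm q ^ j" if "j < i" for i j
      using q False that by (intro power_strict_decreasing) auto
    have less1: "norm (q ^ i) < 1" if "i > 0" for i
      using q that by (simp add: norm_power power_less_one_iff)
    have p: "p \<noteq> 0" "norm p < 1" using False less1[of 5] by (simp_all add: p_def)
    have px: "p / x = q ^ (5 - b)" and py: "p / y = q ^ (5 - a)"
      and pxy: "p / (x * y) = q ^ c" and xy: "x * y = q ^ (a + b)"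
      using False ab by (simp_all add: p_def x_def y_def c_def power_diff power_add mult.commute)
    have k: "qpoch (x * y) p * qpoch (p / (x * y)) p / (qpoch x p * qpoch (p / x) p) =
      qpoch y p * qpoch (p / y) p / qpoch p p ^ 2 *
      ((\<Sum>k. y ^ k / (1 - x * p ^ k)) - p / (x * y) * (\<Sum>k. (p / y) ^ k / (1 - p / x * p ^ k)))"
      using ab p by (intro kronecker_identity)
        (auto simp: p_def x_def y_def norm_power intro!: less less1[unfolded norm_power])
    have W1: "(\<Sum>k. y ^ k / (1 - x * p ^ k)) = ?W1"
      by (simp add: p_def x_def y_def power_add mult.commute flip: power_mult)
    have "p / (x * y) * (\<Sum>k. (p / y) ^ k / (1 - p / x * p ^ k)) =
        (\<Sum>k. p / (x * y) * ((p / y) ^ k / (1 - p / x * p ^ k)))"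
      using less1[of "5 - a"] ab p
      by (intro suminf_mult[symmetric] summable_norm_cancel[OF summable_lambert]) (auto simp: py)
    also have "\<dots> = ?W2"
      unfolding pxy unfolding px py by (simp add: p_def power_add mult_ac flip: power_mult)
    finally have W2: "p / (x * y) * (\<Sum>k. (p / y) ^ k / (1 - p / x * p ^ k)) = ?W2" .
    have nz: "qpoch p p \<noteq> 0" "qpoch y p \<noteq> 0" "qpoch (p / y) p \<noteq> 0"
      using less1[of a, folded y_def] less1[of "5 - a", folded py] ab p
      by (simp_all add: qpoch_nonzero)
    \<comment> \<open>Kronecker's identity solved for its bracket.\<close>
    have "?W1 - ?W2 = qpoch p p ^ 2 / (qpoch y p * qpoch (p / y) p) *
       (qpoch (x * y) p * qpoch (p / (x * y)) p / (qpoch x p * qpoch (p / x) p))"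
      using nz unfolding k W1 W2 by simp
    then show ?thesis
      unfolding pxy unfolding px py xy by (simp add: p_def x_def y_def c_def mult_ac)
  qed
  ultimately show ?thesis by simp
qed

section \<open>Divisors in residue classes and the character sum\<close>

lemma card_divisors_mod_5:
  assumes ab: "a \<in> {1..4}" "b \<in> {1..4}" and m: "a * b mod 5 = m mod 5" "m > 0"
  shows "card {d. d dvd m \<and> d mod 5 = b} = card (rep_pairs a b m)"
proof -
  have "bij_betw (\<lambda>(k, l). 5 * k + b) (rep_pairs a b m) {d. d dvd m \<and> d mod 5 = b}"
  proof (rule bij_betwI[of _ _ _ "\<lambda>d. (d div 5, m div d div 5)"])
    show "(\<lambda>(k, l). 5 * k + b) \<in> rep_pairs a b m \<rightarrow> {d. d dvd m \<and> d mod 5 = b}"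
      using ab by (auto simp: rep_pairs_def)
    show "(\<lambda>d. (d div 5, m div d div 5)) \<in> {d. d dvd m \<and> d mod 5 = b} \<rightarrow> rep_pairs a b m"
    proof
      fix d assume "d \<in> {d. d dvd m \<and> d mod 5 = b}"
      then obtain e where d: "m = d * e" "d mod 5 = b" by auto
      have "m mod 5 = (d mod 5) * (e mod 5) mod 5"
        unfolding d(1) by (simp only: mod_mult_eq)
      \<comment> \<open>Since b is invertible modulo 5, this congruence forces the class of the
        cofactor e to be a; all residues are checked.\<close>
      then have "b * (e mod 5) mod 5 = a * b mod 5"
        using m d(2) by simp
      moreover have "e mod 5 \<in> {0,1,2,3,4}" by auto
      moreover have "a \<in> {1,2,3,4}" "b \<in> {1,2,3,4}" using ab by auto
      ultimately have "e mod 5 = a" by auto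
      then have "5 * (e div 5) + a = e" "5 * (d div 5) + b = d" using d(2) by auto
      moreover have "d > 0" using m d by auto
      ultimately show "(d div 5, m div d div 5) \<in> rep_pairs a b m"
        using d by (simp add: rep_pairs_def)
    qed
    show "(\<lambda>d. (d div 5, m div d div 5)) ((\<lambda>(k, l). 5 * k + b) z) = z"
      if "z \<in> rep_pairs a b m" for z
    proof (cases z)
      case (Pair k l)
      then have "m div (5 * k + b) = 5 * l + a"
        using that ab by (auto simp: rep_pairs_def)
      then show ?thesis using Pair ab by auto
    qed
  qed auto
  then show ?thesis by (simp add: bij_betw_same_card)
qed

lemma sum_chi45_divisors:
  assumes m: "m > 0"
  shows "(\<Sum>d | d dvd m. chi45 (int d)) =
    of_nat (card {d. d dvd m \<and> d mod 5 = 1}) - \<i> * of_nat (card {d. d dvd m \<and> d mod 5 = 2}) +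
    \<i> * of_nat (card {d. d dvd m \<and> d mod 5 = 3}) - of_nat (card {d. d dvd m \<and> d mod 5 = 4})"
proof -
  have fin: "finite {d. d dvd m}" using m by simp
  have "chi45 (int d) = of_bool (d mod 5 = 1) - \<i> * of_bool (d mod 5 = 2) +
      \<i> * of_bool (d mod 5 = 3) - of_bool (d mod 5 = 4)" for d
  proof -
    have e: "int d mod 5 = int (d mod 5)" by (simp add: zmod_int)
    have "d mod 5 \<in> {0, 1, 2, 3, 4}" by auto
    then show ?thesis unfolding chi45_def e by (elim insertE emptyE) simp_all
  qed
  moreover have "(\<Sum>d | d dvd m. of_bool (d mod 5 = s) :: complex) =
      of_nat (card {d. d dvd m \<and> d mod 5 = s})" for s
    using fin by (simp add: of_bool_def sum.If_cases Int_def)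
  ultimately show ?thesis
    by (simp add: sum.distrib sum_subtractf flip: sum_distrib_left)
qed

lemma qpoch_split_5:
  assumes "norm q < 1"
  shows "qpoch q q = qpoch q (q ^ 5) * qpoch (q ^ 2) (q ^ 5) * qpoch (q ^ 3) (q ^ 5) *
    qpoch (q ^ 4) (q ^ 5) * qpoch (q ^ 5) (q ^ 5)"
proof -
  have "{1..5::nat} = {1,2,3,4,5}" by auto
  then show ?thesis
    by (subst qpoch_multisection[OF assms, of 5]) (simp_all add: mult_ac)
qed

lemma sums_power_scaled:
  fixes q :: complex
  assumes "\<And>n. f n = c * g n" "(\<lambda>n. g n * q ^ n) sums S" "c * S = T"
  shows "(\<lambda>n. f n * q ^ n) sums T"
  using sums_mult[OF assms(2), of c] assms(1,3) by (simp add: mult.assoc)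

section \<open>The four generating functions\<close>

theorem theorem1p3:
  fixes q :: complex
  assumes "norm q < 1"
  shows "(\<lambda>n. (\<Sum>d | d dvd 5 * n + 4. chi45 (int d)) * q ^ n) sums
             (- \<i> * qpoch q q * qpoch (q ^ 5) (q ^ 5)
               / (qpoch (q ^ 2) (q ^ 5) ^ 3 * qpoch (q ^ 3) (q ^ 5) ^ 3)) \<and>
         (\<lambda>n. (\<Sum>d | d dvd 5 * n + 3. chi45 (int d)) * q ^ n) sums
             ((1 + \<i>) * qpoch (q ^ 5) (q ^ 5) ^ 2
               / (qpoch (q ^ 2) (q ^ 5) * qpoch (q ^ 3) (q ^ 5))) \<and>
         (\<lambda>n. (\<Sum>d | d dvd 5 * n + 2. chi45 (int d)) * q ^ n) sums
             ((1 - \<i>) * qpoch (q ^ 5) (q ^ 5) ^ 2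
               / (qpoch q (q ^ 5) * qpoch (q ^ 4) (q ^ 5))) \<and>
         (\<lambda>n. (\<Sum>d | d dvd 5 * n + 1. chi45 (int d)) * q ^ n) sums
             (qpoch q q * qpoch (q ^ 5) (q ^ 5)
               / (qpoch q (q ^ 5) ^ 3 * qpoch (q ^ 4) (q ^ 5) ^ 3))"
proof (intro conjI)
  let ?G = "\<lambda>i. qpoch (q ^ i) (q ^ 5)"
  let ?N = "\<lambda>a b m. of_nat (card (rep_pairs a b m)) :: complex"
  have "?G i \<noteq> 0" if "i > 0" for i
    using assms that by (intro qpoch_nonzero) (simp_all add: norm_power power_less_one_iff)
  from this[of 1] this[of 2] this[of 3] this[of 4]
  have nz: "qpoch q (q ^ 5) \<noteq> 0" "?G 2 \<noteq> 0" "?G 3 \<noteq> 0" "?G 4 \<noteq> 0"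
    by simp_all
  \<comment> \<open>Classes 1 and 4 are cofactors of each other and have weights 1 and -1, so they
    cancel; 2 and 3 are self-paired with weights -i and i.\<close>
  have chi: "(\<Sum>d | d dvd m. chi45 (int d)) = - \<i> * (?N 2 2 m - ?N 3 3 m)" if "m mod 5 = 4" for m
  proof -
    have "m > 0" using that by (cases m) auto
    then show ?thesis
      using that sum_chi45_divisors[of m] card_divisors_mod_5[of 4 1 m] card_divisors_mod_5[of 1 4 m]
        card_divisors_mod_5[of 2 2 m] card_divisors_mod_5[of 3 3 m]
        rep_pairs_swap[of 4 1 m]
      by (simp add: algebra_simps)
  qed
  have coeff: "(\<Sum>d | d dvd 5 * n + 4. chi45 (int d)) = - \<i> * (?N 2 2 (5 * n + 4) - ?N 3 3 (5 * n + 4))" for n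
    by (rule chi) presburger
  show "(\<lambda>n. (\<Sum>d | d dvd 5 * n + 4. chi45 (int d)) * q ^ n) sums
      (- \<i> * qpoch q q * ?G 5 / (?G 2 ^ 3 * ?G 3 ^ 3))"
  proof (rule sums_power_scaled[OF coeff])
    show "(\<lambda>n. (?N 2 2 (5 * n + 4) - ?N 3 3 (5 * n + 4)) * q ^ n) sums
        (?G 5 ^ 2 * ?G 4 * qpoch q (q ^ 5) / (?G 2 * ?G 3 * ?G 2 * ?G 3))"
      using rep_pairs_diff_sums[OF assms, of 2 2] by simp
    \<comment> \<open>Expanding the fraction by \<open>?G 2 * ?G 3\<close> completes the numerator
      to (q;q) times \<open>?G 5\<close>.\<close>
    show "- \<i> * (?G 5 ^ 2 * ?G 4 * qpoch q (q ^ 5) / (?G 2 * ?G 3 * ?G 2 * ?G 3)) =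
        - \<i> * qpoch q q * ?G 5 / (?G 2 ^ 3 * ?G 3 ^ 3)"
      using nz by (simp add: qpoch_split_5[OF assms] divide_simps)
        (simp add: algebra_simps power2_eq_square power3_eq_cube)?
  qed
  \<comment> \<open>The pairs 1, 3 and 2, 4 have equal counts by exchange; their weights add up to 1
    + i and -i - 1.\<close>
  have chi: "(\<Sum>d | d dvd m. chi45 (int d)) = (1 + \<i>) * (?N 1 3 m - ?N 4 2 m)" if "m mod 5 = 3" for m
  proof -
    have "m > 0" using that by (cases m) auto
    then show ?thesis
      using that sum_chi45_divisors[of m] card_divisors_mod_5[of 3 1 m] card_divisors_mod_5[of 1 3 m]
        card_divisors_mod_5[of 2 4 m] card_divisors_mod_5[of 4 2 m]
        rep_pairs_swap[of 3 1 m] rep_pairs_swap[of 2 4 m]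
      by (simp add: algebra_simps)
  qed
  have coeff: "(\<Sum>d | d dvd 5 * n + 3. chi45 (int d)) = (1 + \<i>) * (?N 1 3 (5 * n + 3) - ?N 4 2 (5 * n + 3))" for n
    by (rule chi) presburger
  show "(\<lambda>n. (\<Sum>d | d dvd 5 * n + 3. chi45 (int d)) * q ^ n) sums
      ((1 + \<i>) * ?G 5 ^ 2 / (?G 2 * ?G 3))"
  proof (rule sums_power_scaled[OF coeff])
    show "(\<lambda>n. (?N 1 3 (5 * n + 3) - ?N 4 2 (5 * n + 3)) * q ^ n) sums
        (?G 5 ^ 2 * ?G 4 * qpoch q (q ^ 5) / (qpoch q (q ^ 5) * ?G 4 * ?G 3 * ?G 2))"
      using rep_pairs_diff_sums[OF assms, of 1 3] by simp
    show "(1 + \<i>) * (?G 5 ^ 2 * ?G 4 * qpoch q (q ^ 5) / (qpoch q (q ^ 5) * ?G 4 * ?G 3 * ?G 2)) =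
        (1 + \<i>) * ?G 5 ^ 2 / (?G 2 * ?G 3)"
      using nz by (simp add: divide_simps)
        (simp add: algebra_simps power2_eq_square power3_eq_cube)?
  qed
  \<comment> \<open>The pairs are now 1, 2 with total weight 1 - i and 3, 4 with total weight i -
    1.\<close>
  have chi: "(\<Sum>d | d dvd m. chi45 (int d)) = (1 - \<i>) * (?N 1 2 m - ?N 4 3 m)" if "m mod 5 = 2" for m
  proof -
    have "m > 0" using that by (cases m) auto
    then show ?thesis
      using that sum_chi45_divisors[of m] card_divisors_mod_5[of 2 1 m] card_divisors_mod_5[of 1 2 m]
        card_divisors_mod_5[of 3 4 m] card_divisors_mod_5[of 4 3 m]
        rep_pairs_swap[of 2 1 m] rep_pairs_swap[of 3 4 m]
      by (simp add: algebra_simps)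
  qed
  have coeff: "(\<Sum>d | d dvd 5 * n + 2. chi45 (int d)) = (1 - \<i>) * (?N 1 2 (5 * n + 2) - ?N 4 3 (5 * n + 2))" for n
    by (rule chi) presburger
  show "(\<lambda>n. (\<Sum>d | d dvd 5 * n + 2. chi45 (int d)) * q ^ n) sums
      ((1 - \<i>) * ?G 5 ^ 2 / (qpoch q (q ^ 5) * ?G 4))"
  proof (rule sums_power_scaled[OF coeff])
    have sum3: "(1::nat) + 2 = 3" by simp
    show "(\<lambda>n. (?N 1 2 (5 * n + 2) - ?N 4 3 (5 * n + 2)) * q ^ n) sums
        (?G 5 ^ 2 * ?G 3 * ?G 2 / (qpoch q (q ^ 5) * ?G 4 * ?G 2 * ?G 3))"
      using rep_pairs_diff_sums[OF assms, of 1 2]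
      by (simp only: sum3) simp
    show "(1 - \<i>) * (?G 5 ^ 2 * ?G 3 * ?G 2 / (qpoch q (q ^ 5) * ?G 4 * ?G 2 * ?G 3)) =
        (1 - \<i>) * ?G 5 ^ 2 / (qpoch q (q ^ 5) * ?G 4)"
      using nz by (simp add: divide_simps)
        (simp add: algebra_simps power2_eq_square power3_eq_cube)?
  qed
  \<comment> \<open>Now 2 and 3 are cofactors of each other and their weights -i and i cancel; 1 and
    4 are self-paired.\<close>
  have chi: "(\<Sum>d | d dvd m. chi45 (int d)) = 1 * (?N 1 1 m - ?N 4 4 m)" if "m mod 5 = 1" for m
  proof -
    have "m > 0" using that by (cases m) auto
    then show ?thesis
      using that sum_chi45_divisors[of m] card_divisors_mod_5[of 1 1 m] card_divisors_mod_5[of 4 4 m]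
        card_divisors_mod_5[of 3 2 m] card_divisors_mod_5[of 2 3 m]
        rep_pairs_swap[of 3 2 m]
      by (simp add: algebra_simps)
  qed
  have coeff: "(\<Sum>d | d dvd 5 * n + 1. chi45 (int d)) = 1 * (?N 1 1 (5 * n + 1) - ?N 4 4 (5 * n + 1))" for n
    by (rule chi) presburger
  show "(\<lambda>n. (\<Sum>d | d dvd 5 * n + 1. chi45 (int d)) * q ^ n) sums
      (qpoch q q * ?G 5 / (qpoch q (q ^ 5) ^ 3 * ?G 4 ^ 3))"
  proof (rule sums_power_scaled[OF coeff])
    show "(\<lambda>n. (?N 1 1 (5 * n + 1) - ?N 4 4 (5 * n + 1)) * q ^ n) sums
        (?G 5 ^ 2 * ?G 2 * ?G 3 / (qpoch q (q ^ 5) * ?G 4 * qpoch q (q ^ 5) * ?G 4))"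
      using rep_pairs_diff_sums[OF assms, of 1 1] by (simp add: power2_eq_square)
    \<comment> \<open>Here expanding by \<open>qpoch q (q ^ 5) * ?G 4\<close> completes the
      numerator.\<close>
    show "1 * (?G 5 ^ 2 * ?G 2 * ?G 3 / (qpoch q (q ^ 5) * ?G 4 * qpoch q (q ^ 5) * ?G 4)) =
        qpoch q q * ?G 5 / (qpoch q (q ^ 5) ^ 3 * ?G 4 ^ 3)"
      using nz by (simp add: qpoch_split_5[OF assms] divide_simps)
        (simp add: algebra_simps power2_eq_square power3_eq_cube)?
  qed
qed

end
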